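(* For every $\alpha,\beta\ge 0$, the function $$x\mapsto\frac{1}{E_{\alpha,\beta}(x)}$$ is convex on $\mathbb{R}^+$.
   Context: $E_{\alpha,\beta}(x)=\sum_{n\ge 0}\frac{x^n}{\Gamma(\beta+\alpha n)}$ is the two-parameter Mittag-Leffler function, where $1/\Gamma$ is the entire reciprocal Gamma function (equal to $0$ at the non-positive integers). For $\alpha=0$, the function $1/E_{0,\beta}(x)$ on $\mathbb{R}^+$ is understood as $\Gamma(\beta)(1-x)_+$, with $(u)_+=\max(u,0)$. Here $\mathbb{R}^+$ denotes the positive half-line. *)

theory Defs
  imports "HOL-Analysis.Analysis"
begin

text \<open>The coefficients use the entire reciprocal Gamma function, with \<open>rGamma 0 = 0\<close>.\<close>

definition mittag_leffler :: "real \<Rightarrow> real \<Rightarrow> real \<Rightarrow> real" where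
  "mittag_leffler \<alpha> \<beta> x = (\<Sum>n. x ^ n * rGamma (\<beta> + \<alpha> * real n))"

text \<open>
  The reciprocal is extended-valued so that no case rests on the total functions' conventions
  \<open>1 / 0 = 0\<close> and \<open>Gamma 0 = 0\<close> on the reals. Only two cases are affected:
  for \<open>\<beta> = 0 < \<alpha>\<close> the series vanishes at \<open>x = 0\<close>, where the reciprocal is \<open>\<infinity>\<close>;
  and for \<open>\<alpha> = \<beta> = 0\<close> the factor \<open>\<Gamma>(0)\<close>, written \<open>1 / rGamma 0\<close>, is \<open>\<infinity>\<close>,
  so that the function is \<open>\<infinity>\<close> for \<open>x < 1\<close> and (as \<open>\<infinity> * 0 = 0\<close>) is \<open>0\<close> for \<open>x \<ge> 1\<close>.
\<close>

definition recip_mittag_leffler :: "real \<Rightarrow> real \<Rightarrow> real \<Rightarrow> ereal" where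
  "recip_mittag_leffler \<alpha> \<beta> x =
     (if \<alpha> = 0 then (1 / ereal (rGamma \<beta>)) * ereal (max (1 - x) 0)
      else 1 / ereal (mittag_leffler \<alpha> \<beta> x))"

text \<open>
  The defining inequality of \<^const>\<open>convex_on\<close>, for functions with values in \<open>(-\<infinity>, \<infinity>]\<close>.
\<close>

definition ereal_convex_on :: "'a::real_vector set \<Rightarrow> ('a \<Rightarrow> ereal) \<Rightarrow> bool" where
  "ereal_convex_on S f \<longleftrightarrow> convex S \<and>
     (\<forall>x\<in>S. \<forall>y\<in>S. \<forall>u\<ge>0. \<forall>v\<ge>0. u + v = 1 \<longrightarrow>
        f (u *\<^sub>R x + v *\<^sub>R y) \<le> ereal u * f x + ereal v * f y)"

lemma ereal_convex_on_ereal_iff: "ereal_convex_on S (\<lambda>x. ereal (f x)) \<longleftrightarrow> convex_on S f"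
  by (simp add: ereal_convex_on_def convex_on_def)

lemma recip_mittag_leffler_eq_real:
  assumes "\<alpha> \<noteq> 0" "mittag_leffler \<alpha> \<beta> x \<noteq> 0"
  shows "recip_mittag_leffler \<alpha> \<beta> x = ereal (1 / mittag_leffler \<alpha> \<beta> x)"
  using assms by (simp add: recip_mittag_leffler_def one_ereal_def)

lemma recip_mittag_leffler_zero_eq_real:
  assumes "\<beta> > 0"
  shows "recip_mittag_leffler 0 \<beta> x = ereal (Gamma \<beta> * max (1 - x) 0)"
proof -
  have "rGamma \<beta> \<noteq> 0"
    using assms by (auto simp: rGamma_eq_zero_iff elim!: nonpos_Ints_cases)
  then show ?thesis
    by (simp add: recip_mittag_leffler_def one_ereal_def Gamma_def divide_inverse
        ereal_max[symmetric] del: ereal_max)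
qed

lemma recip_mittag_leffler_zero_zero:
  "recip_mittag_leffler 0 0 x = (if x < 1 then \<infinity> else 0)"
  by (auto simp: recip_mittag_leffler_def one_ereal_def max_def zero_ereal_def[symmetric] divide_ereal_def)

end

theory Submission
  imports Defs
begin

text \<open>
  The coefficients of \<open>E\<close> are log-concave because \<open>Gamma\<close> is log-convex, and this alone makes
  \<open>1 / E\<close> convex. Convexity amounts to \<open>E * E'' \<le> 2 * E'\<^sup>2\<close>, and after symmetrisation the coefficient
  of \<open>x ^ (N - 2)\<close> in \<open>E * E'' - 2 * E'\<^sup>2\<close> is the sum over \<open>i \<le> N\<close> of
  \<open>c i * c (N - i)\<close> weighted by \<open>N * (N - 1) / 2 - 3 * i * (N - i)\<close>. The weights sum to zero
  (\<open>1 / (1 - x)\<close> has an affine reciprocal); they decrease towards the middle whereas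
  \<open>c i * c (N - i)\<close> increases, so the sum is nonpositive by Chebyshev's inequality.
\<close>

section \<open>Convolutions of log-concave sequences\<close>

text \<open>Summing the hypothesis over all pairs and expanding gives twice the difference of the
  two sides. Opposite ordering is stated pairwise because the \<open>b\<close> and \<open>w\<close>
  of the application are symmetric about the middle index, hence not monotone in it.\<close>

lemma Chebyshev_sum_opposite:
  fixes b w :: "'a \<Rightarrow> real"
  assumes "\<And>i j. i \<in> A \<Longrightarrow> j \<in> A \<Longrightarrow> (b i - b j) * (w i - w j) \<le> 0"
  shows "real (card A) * (\<Sum>i\<in>A. b i * w i) \<le> sum b A * sum w A"
proof -
  have "(\<Sum>i\<in>A. \<Sum>j\<in>A. (b i - b j) * (w i - w j)) \<le> 0"
    using assms by (intro sum_nonpos)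
  also have "(\<Sum>i\<in>A. \<Sum>j\<in>A. (b i - b j) * (w i - w j)) =
      2 * (real (card A) * (\<Sum>i\<in>A. b i * w i)) - 2 * (sum b A * sum w A)"
    by (simp add: algebra_simps sum.distrib sum_subtractf sum_product sum_distrib_left
        sum.swap[of "\<lambda>i j. b j * w i"])
  finally show ?thesis by simp
qed

text \<open>This is the binomial coefficient of N + 1 over 3; it serves to show that the weights sum
  to zero.\<close>

lemma sum_mult_reflect:
  "(\<Sum>i\<le>N. real i * real (N - i)) = (real N + 1) * real N * (real N - 1) / 6"
proof -
  have 1: "(\<Sum>i\<le>m. real i) = real m * (real m + 1) / 2" for m
    by (induction m) (auto simp: field_simps)
  have 2: "(\<Sum>i\<le>m. real i * real i) = real m * (real m + 1) * (2 * real m + 1) / 6" for m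
    by (induction m) (auto simp: field_simps)
  have "(\<Sum>i\<le>N. real i * real (N - i)) = (\<Sum>i\<le>N. real N * real i - real i * real i)"
    by (intro sum.cong) (auto simp: of_nat_diff algebra_simps)
  also have "\<dots> = real N * (\<Sum>i\<le>N. real i) - (\<Sum>i\<le>N. real i * real i)"
    by (simp add: sum_subtractf sum_distrib_left)
  finally show ?thesis by (simp add: 1 2 field_simps)
qed

text \<open>The product \<open>i * (N - i)\<close> measures how close \<open>i\<close> is to the
  middle. Both sides are invariant under reflection, so each index may be replaced by the smaller
  one of its pair; for indices up to N / 2 the order of these products is the order of the indices,
  and \<open>lc\<close> applies.\<close>

lemma log_concave_mult_reflect_mono:
  fixes a :: "nat \<Rightarrow> real"
  assumes lc: "\<And>i j m n. i \<le> m \<Longrightarrow> i \<le> n \<Longrightarrow> i + j = m + n \<Longrightarrow> a i * a j \<le> a m * a n"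
    and "i \<le> N" "j \<le> N" "i * (N - i) \<le> j * (N - j)"
  shows "a i * a (N - i) \<le> a j * a (N - j)"
proof -
  define p where "p = min i (N - i)"
  define q where "q = min j (N - j)"
  have p: "p * (N - p) = i * (N - i)" "2 * p \<le> N" "a p * a (N - p) = a i * a (N - i)"
    using assms(2) by (auto simp: p_def min_def)
  have q: "q * (N - q) = j * (N - j)" "2 * q \<le> N" "a q * a (N - q) = a j * a (N - j)"
    using assms(3) by (auto simp: q_def min_def)
  have "\<not> q < p"
  proof
    assume "q < p"
    then obtain d where d: "p = q + d" "d > 0" using less_imp_add_positive by blast
    obtain e where e: "N = 2 * p + e" using p(2) le_Suc_ex by blast
    \<comment> \<open>Here N - p = p + e and N - q = p + d + e, so the right side exceeds the left
      by \<open>d * (d + e)\<close>.\<close>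
    have "q * (N - q) < p * (N - p)"
      using d by (simp add: e algebra_simps)
    then show False using p q assms(4) by simp
  qed
  then have "a p * a (N - p) \<le> a q * a (N - q)"
    using p(2) q(2) by (intro lc) auto
  then show ?thesis using p q by simp
qed

text \<open>The two sides are the \<open>N\<close>-th Cauchy product terms of
  \<open>x\<^sup>2 * E * E''\<close> and \<open>2 * (x * E')\<^sup>2\<close>, with the powers of x
  absorbed into \<open>a\<close>.\<close>

lemma log_concave_convolution_le:
  fixes a :: "nat \<Rightarrow> real"
  assumes lc: "\<And>i j m n. i \<le> m \<Longrightarrow> i \<le> n \<Longrightarrow> i + j = m + n \<Longrightarrow> a i * a j \<le> a m * a n"
  shows "(\<Sum>i\<le>N. a i * (real (N - i) * (real (N - i) - 1) * a (N - i))) \<le>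
    2 * (\<Sum>i\<le>N. (real i * a i) * (real (N - i) * a (N - i)))"
proof -
  define b where "b i = a i * a (N - i)" for i
  \<comment> \<open>The average of \<open>v i\<close> and \<open>v (N - i)\<close> is N * (N - 1) /
    2 - i * (N - i); subtracting the 2 * i * (N - i) of the right side yields the factor 3.\<close>
  define w where "w i = real N * (real N - 1) / 2 - 3 * (real i * real (N - i))" for i
  define v where "v i = real (N - i) * (real (N - i) - 1)" for i
  have "(b i - b j) * (w i - w j) \<le> 0" if "i \<le> N" "j \<le> N" for i j
  proof (cases "i * (N - i) \<le> j * (N - j)")
    case True
    then have "real i * real (N - i) \<le> real j * real (N - j)"
      by (metis of_nat_le_iff of_nat_mult)
    moreover have "b i \<le> b j"
      unfolding b_def using lc that True by (rule log_concave_mult_reflect_mono)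
    ultimately show ?thesis by (intro mult_nonpos_nonneg) (auto simp: w_def)
  next
    case False
    then have le: "j * (N - j) \<le> i * (N - i)" by simp
    then have "real j * real (N - j) \<le> real i * real (N - i)"
      by (metis of_nat_le_iff of_nat_mult)
    moreover have "b j \<le> b i"
      unfolding b_def using lc that(2,1) le by (rule log_concave_mult_reflect_mono)
    ultimately show ?thesis by (intro mult_nonneg_nonpos) (auto simp: w_def)
  qed
  then have "real (card {..N}) * (\<Sum>i\<le>N. b i * w i) \<le> sum b {..N} * sum w {..N}"
    by (intro Chebyshev_sum_opposite) auto
  moreover have "sum w {..N} =
      (real N + 1) * (real N * (real N - 1) / 2) - 3 * (\<Sum>i\<le>N. real i * real (N - i))"
    by (simp add: w_def sum_subtractf sum_distrib_left)
  then have "sum w {..N} = 0"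
    unfolding sum_mult_reflect by simp
  ultimately have bw: "(\<Sum>i\<le>N. b i * w i) \<le> 0"
    by (simp add: mult_le_0_iff)
  \<comment> \<open>Symmetrisation: \<open>b\<close> is invariant under i -> N - i, so
    \<open>v\<close> may be averaged with its reflection.\<close>
  have "(\<Sum>i\<le>N. b i * v i) = (\<Sum>i\<le>N. b (N - i) * v (N - i))"
    using sum.atLeastAtMost_rev[of "\<lambda>i. b i * v i" 0 N] by (simp add: atMost_atLeast0)
  also have "\<dots> = (\<Sum>i\<le>N. b i * (real i * (real i - 1)))"
    by (intro sum.cong) (auto simp: b_def v_def)
  finally have "2 * (\<Sum>i\<le>N. b i * v i) = (\<Sum>i\<le>N. b i * v i + b i * (real i * (real i - 1)))"
    by (simp add: sum.distrib)
  also have "\<dots> = (\<Sum>i\<le>N. 2 * (b i * w i) + 4 * (b i * (real i * real (N - i))))"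
    by (intro sum.cong) (auto simp: v_def w_def of_nat_diff field_simps)
  also have "\<dots> = 2 * (\<Sum>i\<le>N. b i * w i) + 4 * (\<Sum>i\<le>N. b i * (real i * real (N - i)))"
    by (simp add: sum.distrib sum_distrib_left)
  finally have "(\<Sum>i\<le>N. b i * v i) \<le> 2 * (\<Sum>i\<le>N. b i * (real i * real (N - i)))"
    using bw by simp
  then show ?thesis by (simp add: b_def v_def mult_ac)
qed

section \<open>Power series with log-concave coefficients\<close>

text \<open>After multiplication by \<open>x\<^sup>2\<close> both sides are Cauchy products of
  series in \<open>a n = c n * x ^ n\<close> with factors n and n * (n - 1), and these are compared
  term by term. Cancelling \<open>x\<^sup>2\<close> requires x > 0, so x = 0 is treated
  apart.\<close>

lemma log_concave_powser_deriv_le: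
  fixes c :: "nat \<Rightarrow> real"
  assumes nonneg: "\<And>n. c n \<ge> 0"
    and lc: "\<And>i j m n. i \<le> m \<Longrightarrow> i \<le> n \<Longrightarrow> i + j = m + n \<Longrightarrow> c i * c j \<le> c m * c n"
    and summable: "\<And>x. summable (\<lambda>n. c n * x ^ n)" and "x \<ge> 0"
  shows "(\<Sum>n. c n * x ^ n) * (\<Sum>n. diffs (diffs c) n * x ^ n) \<le> 2 * (\<Sum>n. diffs c n * x ^ n)\<^sup>2"
proof (cases "x = 0")
  case True
  \<comment> \<open>At 0 the claim reads
    \<open>c 0 * (2 * c 2) \<le> 2 * (c 1)\<^sup>2\<close>.\<close>
  have "c 0 * c 2 \<le> c 1 * c 1" by (rule lc) auto
  then show ?thesis
    using True by (simp add: diffs_def power2_eq_square numeral_2_eq_2)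
next
  case False
  with \<open>x \<ge> 0\<close> have x: "x > 0" by simp
  define E0 where "E0 = (\<Sum>n. c n * x ^ n)"
  define E1 where "E1 = (\<Sum>n. diffs c n * x ^ n)"
  define E2 where "E2 = (\<Sum>n. diffs (diffs c) n * x ^ n)"
  define a where "a n = c n * x ^ n" for n
  have s1: "summable (\<lambda>n. diffs c n * y ^ n)" for y
    using summable by (rule termdiff_converges_all)
  have s2: "summable (\<lambda>n. diffs (diffs c) n * y ^ n)" for y
    using s1 by (rule termdiff_converges_all)
  have a0: "a sums E0"
    using summable[of x] unfolding a_def E0_def by (rule summable_sums)
  have a1: "(\<lambda>n. real n * a n) sums (x * E1)"
  proof -
    \<comment> \<open>The truncated exponent at n = 0 is harmless because of the factor n.\<close>
    have "(\<lambda>n. x * (real n * c n * x ^ (n - Suc 0))) sums (x * E1)"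
      unfolding E1_def using diffs_equiv[OF s1[of x]] by (rule sums_mult)
    moreover have "x * (real n * c n * x ^ (n - Suc 0)) = real n * a n" for n
      by (cases n) (auto simp: a_def)
    ultimately show ?thesis by simp
  qed
  have a2: "(\<lambda>n. real n * (real n - 1) * a n) sums (x\<^sup>2 * E2)"
  proof -
    have "(\<lambda>n. x\<^sup>2 * (real n * diffs c n * x ^ (n - Suc 0))) sums (x\<^sup>2 * E2)"
      unfolding E2_def using diffs_equiv[OF s2[of x]] by (rule sums_mult)
    moreover have "x\<^sup>2 * (real n * diffs c n * x ^ (n - Suc 0)) =
        real (Suc n) * (real (Suc n) - 1) * a (Suc n)" for n
      by (cases n) (auto simp: a_def diffs_def power2_eq_square)
    ultimately have "(\<lambda>n. real (Suc n) * (real (Suc n) - 1) * a (Suc n)) sums (x\<^sup>2 * E2)"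
      by simp
    \<comment> \<open>The index shift leaves the sum unchanged since the term at 0 vanishes.\<close>
    then show ?thesis by (subst (asm) sums_Suc_iff) simp
  qed
  have a_nonneg: "a n \<ge> 0" for n
    using nonneg x by (simp add: a_def)
  have n2: "real n * (real n - 1) * a n \<ge> 0" for n
    using a_nonneg[of n] by (cases n) auto
  have lca: "a i * a j \<le> a m * a n" if "i \<le> m" "i \<le> n" "i + j = m + n" for i j m n
  proof -
    have "a i * a j = (c i * c j) * x ^ (i + j)" by (simp add: a_def power_add)
    also have "\<dots> \<le> (c m * c n) * x ^ (i + j)"
      using lc[OF that] x by (intro mult_right_mono) auto
    also have "\<dots> = a m * a n" by (simp add: that(3) a_def power_add)
    finally show ?thesis .
  qed
  \<comment> \<open>Cauchy products need absolute convergence, which is plain convergence for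
    nonnegative terms.\<close>
  have norm_eq: "norm (a n) = a n" "norm (real n * a n) = real n * a n"
    "norm (real n * (real n - 1) * a n) = real n * (real n - 1) * a n" for n
    using a_nonneg[of n] n2[of n]
    by (simp_all only: real_norm_def abs_of_nonneg mult_nonneg_nonneg of_nat_0_le_iff)
  have "summable (\<lambda>n. norm (a n))" "summable (\<lambda>n. norm (real n * a n))"
    "summable (\<lambda>n. norm (real n * (real n - 1) * a n))"
    unfolding norm_eq using a0 a1 a2 by (auto simp only: sums_iff)
  note prod = Cauchy_product_sums[OF this(1,3)] Cauchy_product_sums[OF this(2,2)]
  have p02: "(\<lambda>N. \<Sum>i\<le>N. a i * (real (N - i) * (real (N - i) - 1) * a (N - i))) sums (E0 * (x\<^sup>2 * E2))"
    using prod(1) by (simp only: sums_unique[OF a0, symmetric] sums_unique[OF a2, symmetric])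
  have p11: "(\<lambda>N. \<Sum>i\<le>N. real i * a i * (real (N - i) * a (N - i))) sums (x * E1 * (x * E1))"
    using prod(2) by (simp only: sums_unique[OF a1, symmetric])
  have "E0 * (x\<^sup>2 * E2) \<le> 2 * ((x * E1) * (x * E1))"
    using log_concave_convolution_le[of a, OF lca] by (rule sums_le[OF _ p02 sums_mult[OF p11]])
  then have "x\<^sup>2 * (E0 * E2) \<le> x\<^sup>2 * (2 * E1\<^sup>2)"
    by (simp add: power2_eq_square mult_ac)
  then show ?thesis using x by (simp add: E0_def E1_def E2_def)
qed

text \<open>The second derivative of 1 / E is \<open>(2 * E'\<^sup>2 - E * E'') / E ^ 3\<close>,
  nonnegative by the preceding inequality. The set \<open>S\<close> is kept general so that 0 can be
  left out when \<open>c 0 = 0\<close>.\<close>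

lemma convex_on_inverse_log_concave_powser:
  fixes c :: "nat \<Rightarrow> real"
  assumes nonneg: "\<And>n. c n \<ge> 0"
    and lc: "\<And>i j m n. i \<le> m \<Longrightarrow> i \<le> n \<Longrightarrow> i + j = m + n \<Longrightarrow> c i * c j \<le> c m * c n"
    and summable: "\<And>x. summable (\<lambda>n. c n * x ^ n)"
    and "convex S" "S \<subseteq> {0..}" and pos: "\<And>x. x \<in> S \<Longrightarrow> (\<Sum>n. c n * x ^ n) > 0"
  shows "convex_on S (\<lambda>x. 1 / (\<Sum>n. c n * x ^ n))"
proof -
  define E0 where "E0 x = (\<Sum>n. c n * x ^ n)" for x
  define E1 where "E1 x = (\<Sum>n. diffs c n * x ^ n)" for x
  define E2 where "E2 x = (\<Sum>n. diffs (diffs c) n * x ^ n)" for x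
  have s1: "summable (\<lambda>n. diffs c n * y ^ n)" for y
    using summable by (rule termdiff_converges_all)
  have D0: "(E0 has_real_derivative E1 x) (at x)" for x
    unfolding E0_def E1_def using summable by (rule termdiffs_strong_converges_everywhere)
  have D1: "(E1 has_real_derivative E2 x) (at x)" for x
    unfolding E1_def E2_def using s1 by (rule termdiffs_strong_converges_everywhere)
  have E0: "E0 x > 0" if "x \<in> S" for x
    using pos[OF that] by (simp add: E0_def)
  have "convex_on S (\<lambda>x. 1 / E0 x)"
  proof (rule f''_ge0_imp_convex[OF \<open>convex S\<close>])
    fix x assume x: "x \<in> S"
    show "((\<lambda>x. 1 / E0 x) has_real_derivative - E1 x / (E0 x)\<^sup>2) (at x)"
      using E0[OF x] by (auto intro!: derivative_eq_intros D0 simp: power2_eq_square)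
    show "((\<lambda>x. - E1 x / (E0 x)\<^sup>2) has_real_derivative
        (2 * (E1 x)\<^sup>2 - E0 x * E2 x) / (E0 x) ^ 3) (at x)"
    proof (rule DERIV_cong)
      show "((\<lambda>x. - E1 x / (E0 x)\<^sup>2) has_real_derivative
          (- E2 x * (E0 x)\<^sup>2 - (- E1 x) * (2 * (E1 x * E0 x))) / ((E0 x)\<^sup>2 * (E0 x)\<^sup>2)) (at x)"
        using E0[OF x] DERIV_power[OF D0, of 2 x]
        by (intro DERIV_divide DERIV_minus D1) auto
      show "(- E2 x * (E0 x)\<^sup>2 - (- E1 x) * (2 * (E1 x * E0 x))) / ((E0 x)\<^sup>2 * (E0 x)\<^sup>2) =
          (2 * (E1 x)\<^sup>2 - E0 x * E2 x) / (E0 x) ^ 3"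
        using E0[OF x] by (simp add: field_simps eval_nat_numeral)
    qed
    have "E0 x * E2 x \<le> 2 * (E1 x)\<^sup>2"
      unfolding E0_def E1_def E2_def using x \<open>S \<subseteq> {0..}\<close>
      by (intro log_concave_powser_deriv_le nonneg lc summable) auto
    then show "(2 * (E1 x)\<^sup>2 - E0 x * E2 x) / (E0 x) ^ 3 \<ge> 0"
      using E0[OF x] by simp
  qed
  then show ?thesis by (simp add: E0_def)
qed

section \<open>The reciprocal Gamma function on the half-line\<close>

lemma rGamma_real_nonneg: "x \<ge> 0 \<Longrightarrow> rGamma (x :: real) \<ge> 0"
  using Gamma_real_pos[of x] by (cases "x = 0") (auto simp: rGamma_inverse_Gamma)

lemma rGamma_real_pos: "x > 0 \<Longrightarrow> rGamma (x :: real) > 0"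
  using Gamma_real_pos[of x] by (auto simp: rGamma_inverse_Gamma)

text \<open>Both \<open>q\<close> and \<open>r\<close> are convex combinations of \<open>p\<close>
  and \<open>s\<close> with interchanged weights, so adding the two convexity inequalities leaves
  weight one on each endpoint.\<close>

lemma convex_on_add_swap_le:
  fixes f :: "real \<Rightarrow> real"
  assumes f: "convex_on S f" and "p \<in> S" "s \<in> S" "p \<le> q" "p \<le> r" "p + s = q + r"
  shows "f q + f r \<le> f p + f s"
proof (cases "p = s")
  case True
  with assms have "q = p" "r = p" by auto
  with True show ?thesis by simp
next
  case False
  with assms have ps: "p < s" by auto
  define u where "u = (q - p) / (s - p)"
  have u: "0 \<le> u" "u \<le> 1" using assms ps by (auto simp: u_def field_simps)
  have "u * (s - p) = q - p" using ps by (simp add: u_def)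
  then have q: "q = (1 - u) * p + u * s" and r: "r = u * p + (1 - u) * s"
    using assms by (auto simp: algebra_simps)
  have "f q \<le> (1 - u) * f p + u * f s" "f r \<le> u * f p + (1 - u) * f s"
    unfolding q r using convex_onD[OF f, of u p s] convex_onD[OF f, of "1 - u" p s] u assms(2,3)
    by auto
  then show ?thesis by (simp add: algebra_simps)
qed

text \<open>For p > 0 this is log-convexity of \<open>Gamma\<close>, exponentiated and inverted. For
  p = 0 the left side vanishes because \<open>rGamma 0 = 0\<close>.\<close>

lemma rGamma_real_log_concave:
  fixes p q r s :: real
  assumes "0 \<le> p" "p \<le> q" "p \<le> r" "p + s = q + r"
  shows "rGamma p * rGamma s \<le> rGamma q * rGamma r"
proof (cases "p = 0")
  case True
  then show ?thesis using assms by (auto intro!: mult_nonneg_nonneg rGamma_real_nonneg)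
next
  case False
  then have pos: "p > 0" "q > 0" "r > 0" "s > 0" using assms by auto
  have "ln (Gamma q) + ln (Gamma r) \<le> ln (Gamma p) + ln (Gamma s)"
    using log_convex_Gamma_real assms pos
    by (intro convex_on_add_swap_le[of "{0<..}" "ln \<circ> Gamma", unfolded o_def]) (auto simp: o_def)
  then have "ln (Gamma q * Gamma r) \<le> ln (Gamma p * Gamma s)"
    using pos by (subst (1 2) ln_mult_pos) auto
  then have "Gamma q * Gamma r \<le> Gamma p * Gamma s"
    using pos by simp
  then show ?thesis
    using pos by (simp add: rGamma_inverse_Gamma le_imp_inverse_le flip: inverse_mult_distrib)
qed

section \<open>Growth of Gamma and the Mittag-Leffler series\<close>

text \<open>Euler's integral is restricted to the unit interval from \<open>M\<close> to
  \<open>M + 1\<close>, where numerator and denominator are bounded by their values at the left and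
  right end. As \<open>M\<close> is free, \<open>Gamma\<close> outgrows every exponential.\<close>

lemma Gamma_real_ge_powr:
  fixes t M :: real
  assumes "t \<ge> 1" "M > 0"
  shows "Gamma t \<ge> M powr (t - 1) / exp (M + 1)"
proof (rule has_integral_le)
  let ?C = "M powr (t - 1) / exp (M + 1)"
  show "((\<lambda>x. if x \<in> {M..M+1} then ?C else 0) has_integral ?C) {0..}"
    using has_integral_const_real[of ?C M "M + 1"] assms
    by (subst has_integral_restrict) auto
  show "((\<lambda>x. x powr (t - 1) / exp x) has_integral Gamma t) {0..}"
    using assms by (intro Gamma_integral_real) auto
  show "(if x \<in> {M..M+1} then ?C else 0) \<le> x powr (t - 1) / exp x" if "x \<in> {0..}" for x
    using assms by (auto intro!: frac_le powr_mono2)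
qed

lemma summable_mittag_leffler:
  fixes \<alpha> \<beta> x :: real
  assumes "\<alpha> > 0" "\<beta> \<ge> 0"
  shows "summable (\<lambda>n. rGamma (\<beta> + \<alpha> * real n) * x ^ n)"
proof -
  \<comment> \<open>Any K > |x| gives a convergent geometric majorant. \<open>M\<close> is chosen
    with \<open>M powr \<alpha> = K\<close>, so that the bound on
    \<open>Gamma (\<beta> + \<alpha> * n)\<close> is a constant times \<open>K ^ n\<close>.\<close>
  define K where "K = \<bar>x\<bar> + 1"
  define M where "M = K powr (1 / \<alpha>)"
  have K: "K > 0" and M: "M > 0" "M powr \<alpha> = K"
    using assms by (auto simp: K_def M_def powr_powr)
  define C where "C = exp (M + 1) / M powr (\<beta> - 1)"
  \<comment> \<open>From here on the argument of \<open>Gamma\<close> is at least 1, as the growth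
    bound demands.\<close>
  have "eventually (\<lambda>n. real n \<ge> 1 / \<alpha>) sequentially"
    using filterlim_real_sequentially by (simp add: filterlim_at_top)
  then have "eventually (\<lambda>n. norm (rGamma (\<beta> + \<alpha> * real n) * x ^ n) \<le> C * (\<bar>x\<bar> / K) ^ n) sequentially"
  proof eventually_elim
    case (elim n)
    define t where "t = \<beta> + \<alpha> * real n"
    have "\<alpha> * real n \<ge> 1" using elim assms by (simp add: field_simps)
    then have t: "t \<ge> 1" using assms by (simp add: t_def)
    have "M powr (t - 1) = M powr (\<beta> - 1) * (M powr \<alpha>) powr real n"
      by (simp add: t_def powr_powr flip: powr_add) (simp add: algebra_simps)
    also have "\<dots> = M powr (\<beta> - 1) * K ^ n"
      using K by (simp add: M powr_realpow)
    finally have eq: "M powr (t - 1) / exp (M + 1) = K ^ n / C"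
      by (simp add: C_def)
    have "K ^ n / C > 0" using K M by (simp add: C_def)
    then have "rGamma t \<le> inverse (K ^ n / C)"
      using Gamma_real_ge_powr[OF t M(1)] unfolding eq rGamma_inverse_Gamma
      by (intro le_imp_inverse_le)
    then have "rGamma t * \<bar>x\<bar> ^ n \<le> inverse (K ^ n / C) * \<bar>x\<bar> ^ n"
      by (intro mult_right_mono) auto
    then show ?case
      using rGamma_real_nonneg[of t] t
      by (simp add: t_def[symmetric] abs_mult power_abs power_divide field_simps)
  qed
  moreover have "summable (\<lambda>n. C * (\<bar>x\<bar> / K) ^ n)"
    by (intro summable_mult summable_geometric) (auto simp: K_def)
  ultimately show ?thesis by (rule summable_comparison_test_ev)
qed

text \<open>The arguments of \<open>rGamma\<close> form an arithmetic progression, so log-concavity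
  of \<open>rGamma\<close> passes to the coefficients.\<close>

lemma convex_on_inverse_mittag_leffler:
  assumes "\<alpha> > 0" "\<beta> \<ge> 0" "convex S" "S \<subseteq> {0..}"
    and "\<And>x. x \<in> S \<Longrightarrow> mittag_leffler \<alpha> \<beta> x > 0"
  shows "convex_on S (\<lambda>x. 1 / mittag_leffler \<alpha> \<beta> x)"
proof -
  let ?c = "\<lambda>n. rGamma (\<beta> + \<alpha> * real n)"
  have "?c i * ?c j \<le> ?c m * ?c n" if "i \<le> m" "i \<le> n" "i + j = m + n" for i j m n
  proof (rule rGamma_real_log_concave)
    have "real i + real j = real m + real n" using that(3) by (metis of_nat_add)
    then show "\<beta> + \<alpha> * real i + (\<beta> + \<alpha> * real j) = \<beta> + \<alpha> * real m + (\<beta> + \<alpha> * real n)"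
      by (metis (no_types, opaque_lifting) add.assoc add.left_commute distrib_left)
  qed (use that assms in auto)
  moreover have "mittag_leffler \<alpha> \<beta> x = (\<Sum>n. ?c n * x ^ n)" for x
    by (simp add: mittag_leffler_def mult.commute)
  ultimately show ?thesis
    using assms
    by (simp add: convex_on_inverse_log_concave_powser summable_mittag_leffler rGamma_real_nonneg)
qed

lemma mittag_leffler_pos:
  assumes "\<alpha> > 0" "\<beta> \<ge> 0" "x \<ge> 0" "\<beta> > 0 \<or> x > 0"
  shows "mittag_leffler \<alpha> \<beta> x > 0"
proof -
  \<comment> \<open>One positive term suffices: the constant one if \<beta> > 0, otherwise the
    linear one, \<open>x * rGamma \<alpha>\<close>.\<close>
  obtain m where m: "x ^ m * rGamma (\<beta> + \<alpha> * real m) > 0"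
  proof (cases "\<beta> > 0")
    case True
    then show ?thesis using that[of 0] by (simp add: rGamma_real_pos)
  next
    case False
    then show ?thesis using that[of 1] assms by (simp add: rGamma_real_pos)
  qed
  show ?thesis
    unfolding mittag_leffler_def
  proof (rule suminf_pos2)
    show "summable (\<lambda>n. x ^ n * rGamma (\<beta> + \<alpha> * real n))"
      using summable_mittag_leffler[OF assms(1,2)] by (simp add: mult.commute)
    show "0 \<le> x ^ n * rGamma (\<beta> + \<alpha> * real n)" for n
      using assms by (simp add: rGamma_real_nonneg)
  qed (rule m)
qed

section \<open>Extended-valued convexity and the cases of the parameters\<close>

lemma ereal_convex_on_cong:
  assumes "\<And>x. x \<in> S \<Longrightarrow> f x = g x"
  shows "ereal_convex_on S f \<longleftrightarrow> ereal_convex_on S g"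
  unfolding ereal_convex_on_def using assms by (auto simp: convex_def)

text \<open>A point outside \<open>T\<close> with positive weight makes the right side infinite.
  With weight zero it contributes nothing, since 0 * \<infinity> = 0 in \<open>ereal\<close>, and
  the combination is just the other point.\<close>

lemma ereal_convex_on_extend:
  assumes "convex S" "ereal_convex_on T f" "T \<subseteq> S"
    and "\<And>x. x \<in> S \<Longrightarrow> f x \<ge> 0" "\<And>x. x \<in> S - T \<Longrightarrow> f x = \<infinity>"
  shows "ereal_convex_on S f"
  unfolding ereal_convex_on_def
proof (intro conjI ballI allI impI)
  fix x y and u v :: real
  assume *: "x \<in> S" "y \<in> S" "0 \<le> u" "0 \<le> v" "u + v = 1"
  have nonneg: "ereal u * f x \<ge> 0" "ereal v * f y \<ge> 0" using * assms(4) by auto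
  consider "u = 0" | "v = 0" | "u > 0" "x \<notin> T" | "v > 0" "y \<notin> T" | "x \<in> T" "y \<in> T"
    using * by force
  then show "f (u *\<^sub>R x + v *\<^sub>R y) \<le> ereal u * f x + ereal v * f y"
  proof cases
    case 5
    then show ?thesis using assms(2) * by (auto simp: ereal_convex_on_def)
  qed (use * assms nonneg in \<open>auto simp: one_ereal_def[symmetric] zero_ereal_def[symmetric]\<close>)
qed (fact assms(1))

theorem proposition3:
  fixes \<alpha> \<beta> :: real
  assumes "\<alpha> \<ge> 0" and "\<beta> \<ge> 0"
  shows "ereal_convex_on {0..} (\<lambda>x. recip_mittag_leffler \<alpha> \<beta> x)"
proof (cases "\<alpha> = 0")
  case \<alpha>: True
  show ?thesis
  proof (cases "\<beta> = 0")
    case True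
    \<comment> \<open>For \<alpha> = \<beta> = 0 the function is zero on \<open>{1..}\<close> and
      infinite to the left of it.\<close>
    have "ereal_convex_on {1..} (\<lambda>x. recip_mittag_leffler 0 0 x) \<longleftrightarrow>
        ereal_convex_on {1..} (\<lambda>x::real. ereal 0)"
      by (intro ereal_convex_on_cong) (auto simp: recip_mittag_leffler_zero_zero)
    then have "ereal_convex_on {1..} (\<lambda>x. recip_mittag_leffler 0 0 x)"
      unfolding ereal_convex_on_ereal_iff by (simp add: convex_on_const)
    then show ?thesis unfolding \<alpha> True
      by (rule ereal_convex_on_extend[rotated]) (auto simp: recip_mittag_leffler_zero_zero)
  next
    case False
    with assms have \<beta>: "\<beta> > 0" by simp
    have "convex_on {0..} (\<lambda>x. max (1 - x) (0::real))"
    proof (rule convex_onI)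
      fix t x y :: real
      assume "0 < t" "t < 1"
      then have "(1 - t) * max (1 - x) 0 \<ge> (1 - t) * (1 - x)" "t * max (1 - y) 0 \<ge> t * (1 - y)"
        "(1 - t) * max (1 - x) 0 \<ge> 0" "t * max (1 - y) 0 \<ge> 0"
        by (auto intro!: mult_left_mono mult_nonneg_nonneg)
      then show "max (1 - ((1 - t) *\<^sub>R x + t *\<^sub>R y)) 0 \<le>
          (1 - t) * max (1 - x) 0 + t * max (1 - y) 0"
        by (intro max.boundedI) (auto simp: algebra_simps)
    qed simp
    then have "convex_on {0..} (\<lambda>x. Gamma \<beta> * max (1 - x) 0)"
      using Gamma_real_pos[OF \<beta>] by (intro convex_on_cmul) auto
    then show ?thesis
      using \<beta> by (simp add: \<alpha> recip_mittag_leffler_zero_eq_real ereal_convex_on_ereal_iff)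
  qed
next
  case False
  with assms have \<alpha>: "\<alpha> > 0" by simp
  \<comment> \<open>\<open>T\<close> is the part of the half-line where the series is positive; 0
    drops out exactly when the constant term \<open>rGamma \<beta>\<close> is zero.\<close>
  define T where "T = (if \<beta> = 0 then {0<..} else {0::real..})"
  have T: "convex T" "T \<subseteq> {0..}" by (auto simp: T_def)
  have pos: "mittag_leffler \<alpha> \<beta> x > 0" if "x \<in> T" for x
    using that \<alpha> assms by (intro mittag_leffler_pos) (auto simp: T_def split: if_splits)
  have eq: "recip_mittag_leffler \<alpha> \<beta> x = ereal (1 / mittag_leffler \<alpha> \<beta> x)" if "x \<in> T" for x
    using pos[OF that] \<alpha> by (intro recip_mittag_leffler_eq_real) auto
  have "ereal_convex_on T (\<lambda>x. ereal (1 / mittag_leffler \<alpha> \<beta> x))"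
    unfolding ereal_convex_on_ereal_iff using \<alpha> assms T pos
    by (intro convex_on_inverse_mittag_leffler) auto
  then have conv: "ereal_convex_on T (\<lambda>x. recip_mittag_leffler \<alpha> \<beta> x)"
    using eq by (simp cong: ereal_convex_on_cong)
  have inf: "recip_mittag_leffler \<alpha> \<beta> x = \<infinity>" if "x \<in> {0..} - T" for x
  proof -
    have "\<beta> = 0" "x = 0" using that by (auto simp: T_def split: if_splits)
    then have "mittag_leffler \<alpha> \<beta> x = 0"
      using powser_zero[of "\<lambda>n. rGamma (\<alpha> * real n)"] by (simp add: mittag_leffler_def mult.commute)
    then show ?thesis using \<alpha> by (simp add: recip_mittag_leffler_def divide_ereal_def)
  qed
  have "recip_mittag_leffler \<alpha> \<beta> x \<ge> 0" if "x \<in> {0..}" for x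
    using inf[of x] eq[of x] pos[of x] that by (cases "x \<in> T") auto
  then show ?thesis
    using conv T inf by (intro ereal_convex_on_extend[of "{0..}" T]) auto
qed

end
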